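(* Let $\mathcal K=\mathcal K_1\times\cdots\times\mathcal K_n\subset\mathbb R^{\bar n}$, where each $\mathcal K_i\subseteq\mathbb R^{d_i}$ is a half-line or a second-order cone, let $A\in\mathbb R^{m\times\bar n}$ have linearly independent rows, and let $\mathcal F=\{x\in\mathcal K: Ax=0,\ \|x\|_\infty\le1\}$. Let $y\in\mathcal K$ and let $k$ be an index such that $\mathcal K_k$ is a second-order cone, $y_{k0}>0$ and $$2\sqrt n\,\|P_Ay\|\le y_{k0}.$$ Put $\hat y_{k}=y_{k}/y_{k0}$ and $\eta=\|\hat y_{k1}\|\in[0,1]$. Define $w,v\in\mathbb R^{d_k}$ as follows: 1. if $0\le\eta\le0.6$, then $w=y_k$ and $v=\tfrac1{\sqrt2}e_k$; 2. if $0.6<\eta\le1$, then $$w=\Bigl(1;\ \tfrac1{\eta^2}\bigl(1-\tfrac1{\sqrt2}\bigr)\hat y_{k1}\Bigr),\qquad v=\Bigl(1;\ -\tfrac1{\eta^2}\bigl(1-\tfrac1{\sqrt2}\bigr)\hat y_{k1}\Bigr).$$ Then $\mathcal F_k\subseteq\mathcal C(w,v)$ and $$\mathrm{vol}(\mathcal C(w,v))\le 0.96^{\,d_k}\,V_{d_k}.$$ Moreover, with $\alpha=w_0/\sqrt{w_0^2-\|w_1\|^2}$ and $\beta=w_1/\sqrt{w_0^2-\|w_1\|^2}$, the matrix $$G=\bigl((\alpha;\beta)^Tv\bigr)\begin{pmatrix}\alpha&-\beta^T\\-\beta&I+\frac{\beta\beta^T}{1+\alpha}\end{pmatrix}$$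 is an element of the automorphism group of $\mathcal K_k$ which maps $\mathcal C(e_k,e_k)$ onto $\mathcal C(w,v)$.
   Context: A half-line is $\{x\in\mathbb R: x\ge 0\}$ ($d_i=1$); the second-order cone in $\mathbb R^{d_i}$, $d_i\ge2$, is $\{(x_0;x_1)\in\mathbb R\times\mathbb R^{d_i-1}:\|x_1\|\le x_0\}$ with the Euclidean norm. $\bar n=\sum_{i=1}^n d_i$. Vectors $x\in\mathbb R^{\bar n}$ are split into blocks $x=(x_1;\dots;x_n)$, $x_i\in\mathbb R^{d_i}$, with $x_i=(x_{i0};x_{i1})\in\mathbb R\times\mathbb R^{d_i-1}$ for second-order cone blocks. $\mathcal F_k=\{x_k: x\in\mathcal F\}\subseteq\mathcal K_k$ is the projection of $\mathcal F$ onto block $k$. $P_A$ is the orthogonal projection onto $\mathrm{Ker}(A)$. $e_k=(1;0)\in\mathbb R\times\mathbb R^{d_k-1}$. For $w,v\in\mathbb R^{d_k}$, $\mathcal C(w,v)=\{x\in\mathcal K_k: w^Tx\le w^Tv\}$. $V_d$ denotes the volume ($d$-dimensional Lebesgue measure) of $\{(x_0;x_1)\in\mathbb R\times\mathbb R^{d-1}:\|x_1\|\le x_0\le1\}$, so $V_{d_k}=\mathrm{vol}(\mathcal C(e_k,e_k))$. The automorphism group of a cone $\mathcal K_k$ is the set of linear maps $G$ with $G\mathcal K_k=\mathcal K_k$. *)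

theory Defs
  imports
    "HOL-Analysis.Lebesgue_Measure"
    "Jordan_Normal_Form.Matrix_Kernel"
begin

unbundle no vec_syntax and no inner_syntax

text \<open>
  Vectors and matrices are those of Jordan_Normal_Form, because the block sizes \<open>d i\<close> vary with
  the block. Blocks are numbered \<open>0..<n\<close>; entry \<open>j\<close> of block \<open>i\<close> is stored at position
  \<open>d 0 + ... + d (i - 1) + j\<close> of the long vector.
\<close>

definition block :: "(nat \<Rightarrow> nat) \<Rightarrow> nat \<Rightarrow> real Matrix.vec \<Rightarrow> real Matrix.vec" where
  "block d i x = Matrix.vec (d i) (\<lambda>j. x $ ((\<Sum>l<i. d l) + j))"

definition head :: "real Matrix.vec \<Rightarrow> real" where
  "head x = x $ 0"

definition tail :: "real Matrix.vec \<Rightarrow> real Matrix.vec" where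
  "tail x = vec_last x (dim_vec x - 1)"

definition l2_norm :: "real Matrix.vec \<Rightarrow> real" where
  "l2_norm x = sqrt (x \<bullet> x)"

definition linf_norm :: "real Matrix.vec \<Rightarrow> real" where
  "linf_norm x = Max (insert 0 {\<bar>x $ i\<bar> | i. i < dim_vec x})"

definition half_line :: "real Matrix.vec set" where
  "half_line = {x \<in> carrier_vec 1. x $ 0 \<ge> 0}"

definition soc :: "nat \<Rightarrow> real Matrix.vec set" where
  "soc r = {x \<in> carrier_vec r. l2_norm (tail x) \<le> head x}"

definition block_cone :: "nat \<Rightarrow> real Matrix.vec set" where
  "block_cone r = (if r = 1 then half_line else soc r)"

definition prod_cone :: "nat \<Rightarrow> (nat \<Rightarrow> nat) \<Rightarrow> real Matrix.vec set" where
  "prod_cone n d = {x \<in> carrier_vec (\<Sum>i<n. d i). \<forall>i<n. block d i x \<in> block_cone (d i)}"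

definition feas :: "nat \<Rightarrow> (nat \<Rightarrow> nat) \<Rightarrow> real Matrix.mat \<Rightarrow> real Matrix.vec set" where
  "feas n d A = {x \<in> prod_cone n d. A *\<^sub>v x = 0\<^sub>v (dim_row A) \<and> linf_norm x \<le> 1}"

definition lin_indep_rows :: "real Matrix.mat \<Rightarrow> bool" where
  "lin_indep_rows A \<longleftrightarrow> distinct (Matrix.rows A) \<and>
     \<not> module.lin_dep class_ring (module_vec TYPE(real) (dim_col A)) (set (Matrix.rows A))"

definition ker_proj :: "real Matrix.mat \<Rightarrow> real Matrix.vec \<Rightarrow> real Matrix.vec" where
  "ker_proj A y = (THE p. p \<in> mat_kernel A \<and> (\<forall>z \<in> mat_kernel A. (y - p) \<bullet> z = 0))"

definition cone_cut :: "nat \<Rightarrow> real Matrix.vec \<Rightarrow> real Matrix.vec \<Rightarrow> real Matrix.vec set" where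
  "cone_cut r w v = {x \<in> block_cone r. w \<bullet> x \<le> w \<bullet> v}"

definition soc_unit :: "nat \<Rightarrow> real Matrix.vec" where
  "soc_unit r = vCons 1 (0\<^sub>v (r - 1))"

text \<open>
  Lebesgue measure on \<open>r\<close>-dimensional vectors, transported along the identification of such a vector
  with its coordinate function on \<open>{..<r}\<close>. It is the Borel measure, so it is meaningful for
  Borel sets only; every set measured below is closed.
\<close>

definition vol :: "nat \<Rightarrow> real Matrix.vec set \<Rightarrow> ennreal" where
  "vol r S = emeasure (Pi\<^sub>M {..<r} (\<lambda>_. lborel)) ((\<lambda>x. restrict (\<lambda>i. x $ i) {..<r}) ` S)"

definition soc_vol :: "nat \<Rightarrow> ennreal" where
  "soc_vol r = vol r {x \<in> carrier_vec r. l2_norm (tail x) \<le> head x \<and> head x \<le> 1}"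

definition cone_aut :: "nat \<Rightarrow> real Matrix.mat set" where
  "cone_aut r = {G \<in> carrier_mat r r. (\<lambda>x. G *\<^sub>v x) ` block_cone r = block_cone r}"

end

theory Submission
  imports Defs
begin

text \<open>
  For \<open>x\<close> in the feasible set, \<open>y\<^sup>T x = (P\<^sub>A y)\<^sup>T x \<le> \<parallel>P\<^sub>A y\<parallel> \<surd>(2 n)\<close>, and self-duality of the
  blocks makes every \<open>y\<^sub>i\<^sup>T x\<^sub>i\<close> nonnegative; so the smallness of \<open>P\<^sub>A y\<close> gives
  \<open>y\<^sub>k\<^sup>T x\<^sub>k \<le> y\<^sub>k\<^sub>0 / \<surd>2\<close>. This is the cut itself in the first case; in the second case the cut is a
  convex combination of this inequality and \<open>x\<^sub>k\<^sub>0 \<le> 1\<close>.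

  \<open>G\<close> is a Lorentz boost followed by a scaling by \<open>g = (\<alpha>; \<beta>)\<^sup>T v\<close>. As the boost sends
  \<open>(\<alpha>; \<beta>)\<close>, which is parallel to \<open>w\<close>, to \<open>e\<^sub>k\<close>, one gets \<open>w\<^sup>T G x = (w\<^sup>T v) x\<^sub>0\<close>. Boosts preserve
  volume, hence the volume ratio is \<open>g\<close> to the power \<open>d\<^sub>k\<close>, and \<open>g \<le> 0.96\<close> in both cases.
\<close>

section \<open>Affine maps and shears under product Lebesgue measure\<close>

lemma product_sigma_finite_lborel: "product_sigma_finite (\<lambda>_. lborel :: real measure)"
  by (intro product_sigma_finite.intro) (rule sigma_finite_lborel)

text \<open>A product measure is determined by its values on boxes. The preimage of a box is again a
  box, and each of its sides obeys the one-dimensional affine rule, so every coordinate contributes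
  one factor \<open>\<bar>c\<bar>\<close>. Serves both the final scaling (\<open>t = 0\<close>) and
  the translations inside a shear (\<open>c = 1\<close>).\<close>

lemma nn_integral_PiM_affine:
  fixes c :: real and t :: "'i \<Rightarrow> real"
  assumes fin: "finite I" and c: "c \<noteq> 0"
    and F: "F \<in> borel_measurable (Pi\<^sub>M I (\<lambda>_. lborel))"
  shows "(\<integral>\<^sup>+f. F f \<partial>Pi\<^sub>M I (\<lambda>_. lborel)) =
    ennreal (\<bar>c\<bar> ^ card I) * (\<integral>\<^sup>+f. F (\<lambda>i\<in>I. t i + c * f i) \<partial>Pi\<^sub>M I (\<lambda>_. lborel))"
proof -
  let ?M = "Pi\<^sub>M I (\<lambda>_. lborel :: real measure)"
  let ?T = "\<lambda>f. \<lambda>i\<in>I. t i + c * f i"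
  interpret product_sigma_finite "\<lambda>_::'i. lborel :: real measure"
    by (rule product_sigma_finite_lborel)
  have T: "?T \<in> measurable ?M ?M"
    by measurable
  have "scale_measure (ennreal (\<bar>c\<bar> ^ card I)) (distr ?M ?M ?T) = ?M"
  proof (rule PiM_eqI[OF fin])
    fix A :: "'i \<Rightarrow> real set" assume A: "\<And>i. i \<in> I \<Longrightarrow> A i \<in> sets lborel"
    define B where "B i = (\<lambda>x. t i + c * x) -` A i" for i
    have B: "B i \<in> sets lborel" if "i \<in> I" for i
    proof -
      have "(\<lambda>x. t i + c * x) -` A i \<inter> space borel \<in> sets borel"
        using A[OF that] by (intro measurable_sets[of _ borel borel]) auto
      then show ?thesis by (simp add: B_def)
    qed
    have vol_B: "emeasure lborel (A i) = ennreal \<bar>c\<bar> * emeasure lborel (B i)" if "i \<in> I" for i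
    proof -
      have "emeasure lborel (A i) =
          emeasure (density (distr lborel borel (\<lambda>x. t i + c * x)) (\<lambda>_. ennreal \<bar>c\<bar>)) (A i)"
        using lborel_real_affine[OF c, of "t i"] by simp
      also have "\<dots> = ennreal \<bar>c\<bar> * emeasure lborel (B i)"
        using A[OF that]
        by (simp add: emeasure_density nn_integral_cmult emeasure_distr B_def)
      finally show ?thesis .
    qed
    have "?T -` Pi\<^sub>E I A \<inter> space ?M = Pi\<^sub>E I B"
      by (auto simp: space_PiM PiE_def Pi_def B_def extensional_def)
    moreover have "Pi\<^sub>E I A \<in> sets ?M"
      using A fin by (intro sets_PiM_I_finite) auto
    ultimately have "emeasure (scale_measure (ennreal (\<bar>c\<bar> ^ card I)) (distr ?M ?M ?T)) (Pi\<^sub>E I A) =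
        ennreal (\<bar>c\<bar> ^ card I) * (\<Prod>i\<in>I. emeasure lborel (B i))"
      using T B by (simp add: emeasure_distr emeasure_PiM[OF fin])
    also have "\<dots> = (\<Prod>i\<in>I. emeasure lborel (A i))"
      by (simp add: vol_B prod.distrib ennreal_power)
    finally show "emeasure (scale_measure (ennreal (\<bar>c\<bar> ^ card I)) (distr ?M ?M ?T)) (Pi\<^sub>E I A) =
        (\<Prod>i\<in>I. emeasure lborel (A i))" .
  qed simp
  then have "(\<integral>\<^sup>+f. F f \<partial>?M) =
      (\<integral>\<^sup>+f. F f \<partial>scale_measure (ennreal (\<bar>c\<bar> ^ card I)) (distr ?M ?M ?T))"
    by simp
  also have "\<dots> = ennreal (\<bar>c\<bar> ^ card I) * (\<integral>\<^sup>+f. F (?T f) \<partial>?M)"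
    using F T by (simp add: nn_integral_scale_measure nn_integral_distr)
  finally show ?thesis .
qed

lemma measurable_shear_coordinate:
  fixes h :: "('i \<Rightarrow> real) \<Rightarrow> real"
  assumes h: "h \<in> borel_measurable (Pi\<^sub>M I (\<lambda>_. lborel))"
  shows "(\<lambda>f. f(i := f i + h (restrict f I))) \<in>
      measurable (Pi\<^sub>M (insert i I) (\<lambda>_. lborel)) (Pi\<^sub>M (insert i I) (\<lambda>_. lborel))"
proof (rule measurable_fun_upd[where J = "insert i I"])
  have "(\<lambda>f. restrict f I) \<in> measurable (Pi\<^sub>M (insert i I) (\<lambda>_. lborel)) (Pi\<^sub>M I (\<lambda>_. lborel))"
    by (rule measurable_restrict_subset) auto
  then have "(\<lambda>f. h (restrict f I)) \<in> borel_measurable (Pi\<^sub>M (insert i I) (\<lambda>_. lborel))"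
    by (rule measurable_compose) (rule h)
  moreover have "(\<lambda>f. f i) \<in> borel_measurable (Pi\<^sub>M (insert i I) (\<lambda>_. lborel :: real measure))"
    by measurable
  ultimately show "(\<lambda>f. f i + h (restrict f I)) \<in> measurable (Pi\<^sub>M (insert i I) (\<lambda>_. lborel)) lborel"
    by simp
qed auto

text \<open>Fubini with coordinate \<open>i\<close> innermost: for fixed other coordinates the map
  only translates coordinate \<open>i\<close>, and one-dimensional Lebesgue measure is translation
  invariant.\<close>

lemma nn_integral_PiM_shear_coordinate:
  fixes h :: "('i \<Rightarrow> real) \<Rightarrow> real"
  assumes fin: "finite I" and i: "i \<notin> I"
    and h [measurable]: "h \<in> borel_measurable (Pi\<^sub>M I (\<lambda>_. lborel))"
    and F [measurable]: "F \<in> borel_measurable (Pi\<^sub>M (insert i I) (\<lambda>_. lborel))"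
  shows "(\<integral>\<^sup>+f. F (f(i := f i + h (restrict f I))) \<partial>Pi\<^sub>M (insert i I) (\<lambda>_. lborel)) =
    (\<integral>\<^sup>+f. F f \<partial>Pi\<^sub>M (insert i I) (\<lambda>_. lborel))"
proof -
  interpret product_sigma_finite "\<lambda>_::'i. lborel :: real measure"
    by (rule product_sigma_finite_lborel)
  note [measurable] = measurable_shear_coordinate[OF h, of i]
  have "(\<integral>\<^sup>+f. F (f(i := f i + h (restrict f I))) \<partial>Pi\<^sub>M (insert i I) (\<lambda>_. lborel)) =
      (\<integral>\<^sup>+x. (\<integral>\<^sup>+y. F (x(i := y + h (restrict (x(i := y)) I))) \<partial>lborel) \<partial>Pi\<^sub>M I (\<lambda>_. lborel))"
    using fin i by (subst product_nn_integral_insert) auto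
  also have "\<dots> = (\<integral>\<^sup>+x. (\<integral>\<^sup>+y. F (x(i := y)) \<partial>lborel) \<partial>Pi\<^sub>M I (\<lambda>_. lborel))"
  proof (rule nn_integral_cong)
    fix x assume x: "x \<in> space (Pi\<^sub>M I (\<lambda>_. lborel :: real measure))"
    \<comment> \<open>The shift depends on the old coordinates only, hence is the constant
      \<open>h x\<close> in the inner integral.\<close>
    have "restrict (x(i := y)) I = x" for y
      using x i by (auto simp: space_PiM PiE_def extensional_def fun_eq_iff)
    moreover have "(\<lambda>y. F (x(i := y))) \<in> borel_measurable borel"
      using x i by measurable
    ultimately show "(\<integral>\<^sup>+y. F (x(i := y + h (restrict (x(i := y)) I))) \<partial>lborel) =
        (\<integral>\<^sup>+y. F (x(i := y)) \<partial>lborel)"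
      using nn_integral_real_affine[of "\<lambda>y. F (x(i := y))" 1 "h x"] by (simp add: add.commute)
  qed
  also have "\<dots> = (\<integral>\<^sup>+f. F f \<partial>Pi\<^sub>M (insert i I) (\<lambda>_. lborel))"
    using fin i by (subst product_nn_integral_insert) auto
  finally show ?thesis .
qed

lemma measurable_shear_along:
  fixes b :: "'i \<Rightarrow> real"
  shows "(\<lambda>f. \<lambda>j\<in>insert i I. if j = i then f i else f j + b j * f i) \<in>
    measurable (Pi\<^sub>M (insert i I) (\<lambda>_. lborel)) (Pi\<^sub>M (insert i I) (\<lambda>_. lborel))"
  by (rule measurable_restrict) auto

text \<open>The complementary shear, by Fubini in the other order: with coordinate \<open>i\<close>
  outermost and frozen at \<open>y\<close>, the remaining coordinates are translated by the
  constants \<open>b j * y\<close>.\<close>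

lemma nn_integral_PiM_shear_along:
  fixes b :: "'i \<Rightarrow> real"
  assumes fin: "finite I" and i: "i \<notin> I"
    and F [measurable]: "F \<in> borel_measurable (Pi\<^sub>M (insert i I) (\<lambda>_. lborel))"
  shows "(\<integral>\<^sup>+f. F (\<lambda>j\<in>insert i I. if j = i then f i else f j + b j * f i) \<partial>Pi\<^sub>M (insert i I) (\<lambda>_. lborel)) =
    (\<integral>\<^sup>+f. F f \<partial>Pi\<^sub>M (insert i I) (\<lambda>_. lborel))"
proof -
  interpret product_sigma_finite "\<lambda>_::'i. lborel :: real measure"
    by (rule product_sigma_finite_lborel)
  define T where "T f = (\<lambda>j\<in>insert i I. if j = i then f i else f j + b j * f i)" for f
  have [measurable]: "T \<in> measurable (Pi\<^sub>M (insert i I) (\<lambda>_. lborel)) (Pi\<^sub>M (insert i I) (\<lambda>_. lborel))"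
    unfolding T_def by (rule measurable_shear_along)
  have "(\<integral>\<^sup>+f. F (T f) \<partial>Pi\<^sub>M (insert i I) (\<lambda>_. lborel)) =
      (\<integral>\<^sup>+y. (\<integral>\<^sup>+x. F (T (x(i := y))) \<partial>Pi\<^sub>M I (\<lambda>_. lborel)) \<partial>lborel)"
    using fin i by (subst product_nn_integral_insert_rev) auto
  also have "\<dots> = (\<integral>\<^sup>+y. (\<integral>\<^sup>+x. F (x(i := y)) \<partial>Pi\<^sub>M I (\<lambda>_. lborel)) \<partial>lborel)"
  proof (rule nn_integral_cong)
    fix y :: real
    have "T (x(i := y)) = (\<lambda>j\<in>I. b j * y + 1 * x j)(i := y)" for x
      using i by (auto simp: T_def fun_eq_iff)
    moreover have "(\<lambda>x. F (x(i := y))) \<in> borel_measurable (Pi\<^sub>M I (\<lambda>_. lborel))"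
      using i by measurable
    ultimately show "(\<integral>\<^sup>+x. F (T (x(i := y))) \<partial>Pi\<^sub>M I (\<lambda>_. lborel)) =
        (\<integral>\<^sup>+x. F (x(i := y)) \<partial>Pi\<^sub>M I (\<lambda>_. lborel))"
      using nn_integral_PiM_affine[OF fin, of 1 "\<lambda>x. F (x(i := y))" "\<lambda>j. b j * y"] by simp
  qed
  also have "\<dots> = (\<integral>\<^sup>+f. F f \<partial>Pi\<^sub>M (insert i I) (\<lambda>_. lborel))"
    using fin i by (subst product_nn_integral_insert_rev) auto
  finally show ?thesis unfolding T_def .
qed

section \<open>Head, tail, Euclidean norm and the second-order cone\<close>

lemma vec_eq_vCons_head_tail:
  assumes "x \<in> carrier_vec (Suc q)"
  shows "x = vCons (head x) (tail x)"
  using assms by (intro eq_vecI) (auto simp: head_def tail_def vec_last_def vec_index_vCons)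

lemma tail_carrier: "x \<in> carrier_vec (Suc q) \<Longrightarrow> tail x \<in> carrier_vec q"
  by (auto simp: tail_def)

lemma carrier_vec_SucE:
  fixes x :: "real Matrix.vec"
  assumes "x \<in> carrier_vec (Suc q)"
  obtains a z where "x = vCons a z" "z \<in> carrier_vec q"
  using that[OF vec_eq_vCons_head_tail[OF assms] tail_carrier[OF assms]] .

lemma head_vCons [simp]: "head (vCons a x) = a"
  by (simp add: head_def)

lemma tail_vCons [simp]: "tail (vCons a x) = x"
  by (intro eq_vecI) (auto simp: tail_def vec_last_def)

lemma scalar_prod_self_nonneg: "0 \<le> (x :: real Matrix.vec) \<bullet> x"
  by (auto simp: scalar_prod_def intro!: sum_nonneg)

lemma scalar_prod_le_l2_norm:
  assumes "x \<in> carrier_vec q" "y \<in> carrier_vec q"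
  shows "\<bar>x \<bullet> y\<bar> \<le> l2_norm x * l2_norm y"
proof -
  have "(x \<bullet> y)\<^sup>2 \<le> (x \<bullet> x) * (y \<bullet> y)"
    using assms Cauchy_Schwarz_ineq_sum[of "\<lambda>i. x $ i" "\<lambda>i. y $ i" "{0..<q}"]
    by (simp add: scalar_prod_def power2_eq_square)
  then have "sqrt ((x \<bullet> y)\<^sup>2) \<le> sqrt ((x \<bullet> x) * (y \<bullet> y))"
    by (rule real_sqrt_le_mono)
  then show ?thesis
    by (simp add: l2_norm_def real_sqrt_mult)
qed

lemma l2_norm_nonneg [simp]: "0 \<le> l2_norm x"
  by (simp add: l2_norm_def scalar_prod_self_nonneg)

lemma l2_norm_square: "(l2_norm x)\<^sup>2 = x \<bullet> x"
  by (simp add: l2_norm_def scalar_prod_self_nonneg)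

lemma l2_norm_smult: "l2_norm (c \<cdot>\<^sub>v x) = \<bar>c\<bar> * l2_norm x"
proof -
  have "l2_norm (c \<cdot>\<^sub>v x) = sqrt (c\<^sup>2 * (x \<bullet> x))"
    by (simp add: l2_norm_def power2_eq_square mult.assoc)
  then show ?thesis
    by (simp add: l2_norm_def real_sqrt_mult)
qed

text \<open>Squaring is an equivalence only together with the sign condition on \<open>a\<close>. In
  this root-free form, cone membership becomes a polynomial condition, as needed for the boost
  computations and for measurability.\<close>

lemma vCons_in_soc_iff:
  assumes "x \<in> carrier_vec q"
  shows "vCons a x \<in> soc (Suc q) \<longleftrightarrow> 0 \<le> a \<and> x \<bullet> x \<le> a\<^sup>2"
proof -
  have "l2_norm x \<le> a \<longleftrightarrow> 0 \<le> a \<and> (l2_norm x)\<^sup>2 \<le> a\<^sup>2"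
    using l2_norm_nonneg[of x] power_mono[of "l2_norm x" a 2] power2_le_imp_le[of "l2_norm x" a]
      order_trans[of 0 "l2_norm x" a]
    by blast
  then have "l2_norm x \<le> a \<longleftrightarrow> 0 \<le> a \<and> x \<bullet> x \<le> a\<^sup>2"
    by (simp only: l2_norm_square)
  with assms show ?thesis by (simp add: soc_def)
qed

section \<open>Block decomposition and bounds on feasible points\<close>

lemma sum_blocks:
  fixes f :: "nat \<Rightarrow> 'a :: comm_monoid_add" and d :: "nat \<Rightarrow> nat"
  shows "(\<Sum>j<(\<Sum>i<n. d i). f j) = (\<Sum>i<n. \<Sum>j<d i. f ((\<Sum>l<i. d l) + j))"
proof (induction n)
  case (Suc n)
  have "(\<Sum>j<a + b. f j) = (\<Sum>j<a. f j) + (\<Sum>j<b. f (a + j))" for a b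
    by (induction b) (simp_all add: ac_simps)
  with Suc show ?case by simp
qed simp

lemma scalar_prod_blocks:
  assumes "x \<in> carrier_vec (\<Sum>i<n. d i)" "y \<in> carrier_vec (\<Sum>i<n. d i)"
  shows "x \<bullet> y = (\<Sum>i<n. block d i x \<bullet> block d i y)"
proof -
  have "x \<bullet> y = (\<Sum>j<(\<Sum>i<n. d i). x $ j * y $ j)"
    using assms by (simp add: scalar_prod_def atLeast0LessThan)
  also have "\<dots> = (\<Sum>i<n. block d i x \<bullet> block d i y)"
    by (simp add: sum_blocks scalar_prod_def block_def atLeast0LessThan)
  finally show ?thesis .
qed

lemma block_carrier: "block d i x \<in> carrier_vec (d i)"
  by (simp add: block_def)

lemma block_cone_cases:
  assumes "x \<in> block_cone r" "r \<ge> 1"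
  obtains (half_line) a where "r = 1" "0 \<le> a" "x = vCons a vNil"
  | (soc) q a z where "r = Suc q" "q \<ge> 1" "z \<in> carrier_vec q" "0 \<le> a" "z \<bullet> z \<le> a\<^sup>2" "l2_norm z \<le> a" "x = vCons a z"
proof (cases "r = 1")
  case True
  then have "x \<in> carrier_vec 1" "0 \<le> x $ 0"
    using assms by (auto simp: block_cone_def half_line_def)
  moreover then have "x = vCons (x $ 0) vNil"
    by (intro eq_vecI) auto
  ultimately show ?thesis using True half_line by blast
next
  case False
  then obtain q where q: "r = Suc q" "q \<ge> 1" using assms(2) by (cases r) auto
  have x: "x \<in> soc (Suc q)" using assms(1) False by (simp add: block_cone_def q)
  then have c: "x \<in> carrier_vec (Suc q)" and le: "l2_norm (tail x) \<le> head x" by (auto simp: soc_def)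
  have "vCons (head x) (tail x) \<in> soc (Suc q)"
    using x vec_eq_vCons_head_tail[OF c] by simp
  then have "0 \<le> head x" "tail x \<bullet> tail x \<le> (head x)\<^sup>2"
    using vCons_in_soc_iff[OF tail_carrier[OF c]] by auto
  then show ?thesis
    by (rule soc[OF q tail_carrier[OF c] _ _ le vec_eq_vCons_head_tail[OF c]])
qed

text \<open>The half of self-duality that is needed: by Cauchy-Schwarz the tails contribute at least
  \<open>- (a * a')\<close>, which the product of the heads compensates.\<close>

lemma block_cone_scalar_prod_nonneg:
  assumes "x \<in> block_cone r" "y \<in> block_cone r" "r \<ge> 1"
  shows "0 \<le> x \<bullet> y"
  using assms(1,3)
proof (cases rule: block_cone_cases)
  case (half_line a)
  from assms(2,3) show ?thesis
  proof (cases rule: block_cone_cases)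
    case (half_line a')
    then show ?thesis using \<open>0 \<le> a\<close> \<open>x = vCons a vNil\<close> by simp
  qed (use half_line in simp)
next
  case (soc q a z)
  from assms(2,3) show ?thesis
  proof (cases rule: block_cone_cases)
    case (soc q' a' z')
    have "\<bar>z \<bullet> z'\<bar> \<le> l2_norm z * l2_norm z'"
      using soc \<open>r = Suc q\<close> \<open>z \<in> carrier_vec q\<close> by (intro scalar_prod_le_l2_norm[of _ q]) auto
    also have "\<dots> \<le> a * a'"
      using soc \<open>l2_norm z \<le> a\<close> \<open>0 \<le> a\<close> by (intro mult_mono) auto
    finally show ?thesis using soc \<open>x = vCons a z\<close> by simp
  qed (use soc in simp)
qed

text \<open>Head and tail each contribute at most 1 to the square, whatever the dimension of the
  block. This is the origin of the factor \<open>sqrt 2\<close> in the bounds below.\<close>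

lemma block_cone_scalar_prod_self_le:
  assumes "x \<in> block_cone r" "r \<ge> 1" "x $ 0 \<le> 1"
  shows "x \<bullet> x \<le> 2"
  using assms(1,2)
proof (cases rule: block_cone_cases)
  case (half_line a)
  then have "a * a \<le> 1 * 1" using assms(3) by (intro mult_mono) auto
  with half_line show ?thesis by simp
next
  case (soc q a z)
  then have "a * a \<le> 1 * 1" using assms(3) by (intro mult_mono) auto
  with soc show ?thesis by (simp add: power2_eq_square)
qed

lemma index_le_linf_norm:
  assumes "i < dim_vec x"
  shows "\<bar>x $ i\<bar> \<le> linf_norm x"
  unfolding linf_norm_def using assms by (intro Max_ge) auto

lemma feas_block_head_le:
  assumes "x \<in> feas n d A" "i < n" "d i \<ge> 1"
  shows "block d i x $ 0 \<le> 1"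
proof -
  have "(\<Sum>l<Suc i. d l) \<le> (\<Sum>l<n. d l)"
    using assms(2) by (intro sum_mono2) auto
  then have "(\<Sum>l<i. d l) < (\<Sum>l<n. d l)" using assms(3) by simp
  then have "\<bar>x $ (\<Sum>l<i. d l)\<bar> \<le> 1"
    using assms(1) index_le_linf_norm[of "\<Sum>l<i. d l" x]
    by (auto simp: feas_def prod_cone_def)
  then show ?thesis using assms(3) by (simp add: block_def)
qed

lemma feas_l2_norm_le:
  assumes "\<And>i. i < n \<Longrightarrow> d i \<ge> 1" "x \<in> feas n d A"
  shows "l2_norm x \<le> sqrt 2 * sqrt (real n)"
proof -
  have x: "x \<in> prod_cone n d" using assms(2) by (simp add: feas_def)
  have "x \<bullet> x = (\<Sum>i<n. block d i x \<bullet> block d i x)"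
    using x by (intro scalar_prod_blocks) (auto simp: prod_cone_def)
  also have "\<dots> \<le> (\<Sum>i<n. 2)"
    using x assms feas_block_head_le[OF assms(2)]
    by (intro sum_mono block_cone_scalar_prod_self_le) (auto simp: prod_cone_def)
  finally show ?thesis
    by (simp add: l2_norm_def mult.commute flip: real_sqrt_mult)
qed

section \<open>The orthogonal projection onto the kernel\<close>

text \<open>Gram-Schmidt in the form of an induction over the constraints. The induction hypothesis
  is applied to \<open>y\<close> and also to the new constraint \<open>r\<close>, hence
  \<open>y\<close> is arbitrary; subtracting from the projection of \<open>y\<close> its component
  along the projection \<open>q\<close> of \<open>r\<close> enforces the new constraint.\<close>

lemma orthogonal_decomposition:
  fixes y :: "real Matrix.vec"
  assumes "set rs \<subseteq> carrier_vec N" "y \<in> carrier_vec N"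
  shows "\<exists>p \<in> carrier_vec N. (\<forall>r \<in> set rs. r \<bullet> p = 0) \<and>
    (\<forall>z \<in> carrier_vec N. (\<forall>r \<in> set rs. r \<bullet> z = 0) \<longrightarrow> (y - p) \<bullet> z = 0)"
  using assms
proof (induction rs arbitrary: y)
  case Nil
  then show ?case by (intro bexI[of _ y]) (auto simp: minus_cancel_vec)
next
  case (Cons r rs)
  then have r: "r \<in> carrier_vec N" and rs: "set rs \<subseteq> carrier_vec N" by auto
  obtain p where p: "p \<in> carrier_vec N" "\<forall>s \<in> set rs. s \<bullet> p = 0"
    "\<And>z. z \<in> carrier_vec N \<Longrightarrow> \<forall>s \<in> set rs. s \<bullet> z = 0 \<Longrightarrow> (y - p) \<bullet> z = 0"
    using Cons.IH[OF rs Cons.prems(2)] by auto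
  obtain q where q: "q \<in> carrier_vec N" "\<forall>s \<in> set rs. s \<bullet> q = 0"
    "\<And>z. z \<in> carrier_vec N \<Longrightarrow> \<forall>s \<in> set rs. s \<bullet> z = 0 \<Longrightarrow> (r - q) \<bullet> z = 0"
    using Cons.IH[OF rs r] by auto
  \<comment> \<open>On vectors satisfying the old constraints, \<open>r\<close> and \<open>q\<close>
    are the same functional, so \<open>q\<close> can replace \<open>r\<close> throughout.\<close>
  have rq: "r \<bullet> z = q \<bullet> z" if "z \<in> carrier_vec N" "\<forall>s \<in> set rs. s \<bullet> z = 0" for z
    using q(3)[OF that] minus_scalar_prod_distrib[OF r q(1) that(1)] by simp
  define t where "t = (p \<bullet> q) / (q \<bullet> q)"
  define p' where "p' = p - t \<cdot>\<^sub>v q"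
  have p': "p' \<in> carrier_vec N" using p(1) q(1) by (simp add: p'_def)
  have prod: "s \<bullet> p' = s \<bullet> p - t * (s \<bullet> q)" if "s \<in> carrier_vec N" for s
    using that p(1) q(1) by (simp add: p'_def scalar_prod_minus_distrib[of _ N])
  have orth: "\<forall>s \<in> set rs. s \<bullet> p' = 0"
    using p q rs by (auto simp: prod)
  have "q \<bullet> p' = 0"
  \<comment> \<open>If \<open>r\<close> is a combination of the old constraints, then
    \<open>q\<close> is zero and the quotient \<open>t\<close> takes its default value 0; the new
    constraint then holds automatically.\<close>
  proof (cases "q \<bullet> q = 0")
    case True
    then have "l2_norm q = 0" by (simp add: l2_norm_def)
    then have "q \<bullet> p' = 0" using scalar_prod_le_l2_norm[OF q(1) p'] by simp
    then show ?thesis .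
  next
    case False
    then show ?thesis
      using p(1) q(1) by (simp add: prod t_def comm_scalar_prod[of p N q])
  qed
  then have "r \<bullet> p' = 0" using rq[OF p' orth] by simp
  moreover have "(y - p') \<bullet> z = 0" if z: "z \<in> carrier_vec N" "\<forall>s \<in> set (r # rs). s \<bullet> z = 0" for z
  proof -
    have "(y - p) \<bullet> z = 0" "q \<bullet> z = 0" using z p(3) rq by auto
    moreover have "(y - p') \<bullet> z = (y - p) \<bullet> z + t * (q \<bullet> z)"
      using z(1) p(1) q(1) Cons.prems(2)
      by (simp add: p'_def minus_scalar_prod_distrib[of _ N])
    ultimately show ?thesis by simp
  qed
  ultimately show ?case using orth p' by (intro bexI[of _ p']) auto
qed

text \<open>Justifies the definite description in \<open>ker_proj\<close>. Existence is the
  decomposition above with the rows of \<open>A\<close> as constraints; for uniqueness, the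
  difference of two candidates lies in the kernel and is orthogonal to the kernel, hence to
  itself.\<close>

lemma ker_proj_properties:
  assumes A: "A \<in> carrier_mat m N" and y: "y \<in> carrier_vec N"
  shows "ker_proj A y \<in> mat_kernel A" "\<And>z. z \<in> mat_kernel A \<Longrightarrow> (y - ker_proj A y) \<bullet> z = 0"
proof -
  have ker: "z \<in> mat_kernel A \<longleftrightarrow> z \<in> carrier_vec N \<and> (\<forall>r \<in> set (Matrix.rows A). r \<bullet> z = 0)" for z
    using A by (auto simp: mat_kernel_def Matrix.rows_def vec_eq_iff mult_mat_vec_def)
  let ?P = "\<lambda>p. p \<in> mat_kernel A \<and> (\<forall>z \<in> mat_kernel A. (y - p) \<bullet> z = 0)"
  have "set (Matrix.rows A) \<subseteq> carrier_vec N" using A by (auto simp: Matrix.rows_def)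
  from orthogonal_decomposition[OF this y] obtain p
    where "p \<in> carrier_vec N" "\<forall>r \<in> set (Matrix.rows A). r \<bullet> p = 0"
      "\<forall>z \<in> carrier_vec N. (\<forall>r \<in> set (Matrix.rows A). r \<bullet> z = 0) \<longrightarrow> (y - p) \<bullet> z = 0"
    by (elim bexE conjE)
  then have p: "?P p" by (simp add: ker)
  moreover have "p' = p" if p': "?P p'" for p'
  proof -
    have c: "p \<in> carrier_vec N" "p' \<in> carrier_vec N" using p p' by (auto simp: ker)
    have "p' - p \<in> mat_kernel A"
      using p p' \<open>set (Matrix.rows A) \<subseteq> carrier_vec N\<close> by (auto simp: ker scalar_prod_minus_distrib[of _ N])
    then have "(y - p) \<bullet> (p' - p) = 0" "(y - p') \<bullet> (p' - p) = 0" using p p' by auto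
    moreover have "(p' - p) \<bullet> (p' - p) = (y - p) \<bullet> (p' - p) - (y - p') \<bullet> (p' - p)"
      using c y by (simp add: minus_scalar_prod_distrib[of _ N] scalar_prod_minus_distrib[of _ N])
    ultimately have "(p' - p) \<bullet> (p' - p) = 0" by simp
    then have "p' - p = 0\<^sub>v N"
      using conjugate_square_eq_0_vec[of "p' - p" N] c by simp
    then have "(p' - p) $ i = 0" if "i < N" for i using that by simp
    then show ?thesis using c by (intro eq_vecI) (auto)
  qed
  ultimately have "?P (THE p. ?P p)" by (intro theI[of ?P])
  then show "ker_proj A y \<in> mat_kernel A" "\<And>z. z \<in> mat_kernel A \<Longrightarrow> (y - ker_proj A y) \<bullet> z = 0"
    by (auto simp: ker_proj_def)
qed

lemma block_scalar_prod_le: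
  assumes dims: "\<And>i. i < n \<Longrightarrow> d i \<ge> 1" and A: "A \<in> carrier_mat m (\<Sum>i<n. d i)"
    and y: "y \<in> prod_cone n d" and k: "k < n" and x: "x \<in> feas n d A"
  shows "block d k y \<bullet> block d k x \<le> sqrt 2 * sqrt (real n) * l2_norm (ker_proj A y)"
proof -
  let ?N = "\<Sum>i<n. d i" and ?p = "ker_proj A y"
  have c: "y \<in> carrier_vec ?N" "x \<in> carrier_vec ?N" and xc: "x \<in> prod_cone n d"
    using x y by (auto simp: prod_cone_def feas_def)
  have xk: "x \<in> mat_kernel A" using x A c by (auto simp: feas_def mat_kernel_def)
  have p: "?p \<in> carrier_vec ?N"
    using ker_proj_properties(1)[OF A c(1)] A by (auto simp: mat_kernel_def)
  have "block d k y \<bullet> block d k x \<le> (\<Sum>i<n. block d i y \<bullet> block d i x)"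
    using k dims xc y
    by (intro member_le_sum block_cone_scalar_prod_nonneg) (auto simp: prod_cone_def)
  also have "\<dots> = y \<bullet> x" using scalar_prod_blocks[OF c] by simp
  also have "\<dots> = ?p \<bullet> x"
    using ker_proj_properties(2)[OF A c(1) xk] minus_scalar_prod_distrib[OF c(1) p c(2)] by simp
  also have "\<dots> \<le> l2_norm ?p * l2_norm x" using scalar_prod_le_l2_norm[OF p c(2)] by simp
  also have "\<dots> \<le> l2_norm ?p * (sqrt 2 * sqrt (real n))"
    using feas_l2_norm_le[OF dims x] by (intro mult_left_mono) auto
  finally show ?thesis by (simp add: ac_simps)
qed

section \<open>Lorentz boosts\<close>

text \<open>The action of the matrix in \<open>G\<close> before scaling: the multiple of
  \<open>\<beta>\<close> added to the tail collects the first column and the rank-one term. It is a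
  Lorentz boost once \<open>\<beta> \<bullet> \<beta> = \<alpha>\<^sup>2 - 1\<close>.\<close>

definition boost :: "real \<Rightarrow> real Matrix.vec \<Rightarrow> real Matrix.vec \<Rightarrow> real Matrix.vec" where
  "boost \<alpha> \<beta> x = vCons (\<alpha> * head x - \<beta> \<bullet> tail x)
     (tail x + ((\<beta> \<bullet> tail x) / (1 + \<alpha>) - head x) \<cdot>\<^sub>v \<beta>)"

text \<open>Links the block matrix to the vector formula by reading off its rows; afterwards matrix
  entries no longer appear.\<close>

lemma boost_mat_mult_vec:
  assumes \<beta>: "\<beta> \<in> carrier_vec q" and x: "x \<in> carrier_vec (Suc q)"
  shows "(g \<cdot>\<^sub>m four_block_mat
        (Matrix.mat 1 1 (\<lambda>_. \<alpha>))
        (mat_of_rows q [- \<beta>])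
        (mat_of_cols q [- \<beta>])
        (1\<^sub>m q + (1 / (1 + \<alpha>)) \<cdot>\<^sub>m (mat_of_cols q [\<beta>] * mat_of_rows q [\<beta>]))) *\<^sub>v x
    = g \<cdot>\<^sub>v boost \<alpha> \<beta> x" (is "(g \<cdot>\<^sub>m ?L) *\<^sub>v x = _")
proof -
  obtain a z where xz: "x = vCons a z" and z: "z \<in> carrier_vec q"
    using x by (rule carrier_vec_SucE)
  have L: "?L \<in> carrier_mat (Suc q) (Suc q)"
    by (rule carrier_matI) simp_all
  have row0: "Matrix.row ?L 0 = vCons \<alpha> (- \<beta>)"
    using \<beta> by (intro eq_vecI) (auto simp: vec_index_vCons mat_of_rows_def)
  have rowS: "Matrix.row ?L (Suc i) = vCons (- \<beta> $ i) (unit_vec q i + (\<beta> $ i / (1 + \<alpha>)) \<cdot>\<^sub>v \<beta>)"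
    if "i < q" for i
    using \<beta> that
    by (intro eq_vecI)
      (auto simp: vec_index_vCons mat_of_rows_def mat_of_cols_def scalar_prod_def unit_vec_def)
  have "(g \<cdot>\<^sub>m ?L) *\<^sub>v x = g \<cdot>\<^sub>v (?L *\<^sub>v x)"
    using L x by (intro eq_vecI) auto
  also have "?L *\<^sub>v x = boost \<alpha> \<beta> x"
  proof (rule eq_vecI)
    show "dim_vec (?L *\<^sub>v x) = dim_vec (boost \<alpha> \<beta> x)"
      using L \<beta> z by (simp add: boost_def xz)
    fix i assume "i < dim_vec (boost \<alpha> \<beta> x)"
    then have i: "i < Suc q" using \<beta> z by (simp add: boost_def xz)
    then have "(?L *\<^sub>v x) $ i = Matrix.row ?L i \<bullet> x"
      using L by (intro index_mult_mat_vec) auto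
    also have "\<dots> = boost \<alpha> \<beta> x $ i"
    proof (cases i)
      case 0
      then show ?thesis using \<beta> z by (simp only: 0 row0) (simp add: boost_def xz)
    next
      case (Suc j)
      then have j: "j < q" using i by simp
      have "(unit_vec q j + (\<beta> $ j / (1 + \<alpha>)) \<cdot>\<^sub>v \<beta>) \<bullet> z = z $ j + (\<beta> $ j / (1 + \<alpha>)) * (\<beta> \<bullet> z)"
        using \<beta> z j by (simp add: add_scalar_prod_distrib[of _ q])
      then show ?thesis using \<beta> z j
        by (simp only: Suc rowS[OF j]) (simp add: boost_def xz algebra_simps)
    qed
    finally show "(?L *\<^sub>v x) $ i = boost \<alpha> \<beta> x $ i" .
  qed
  finally show ?thesis .
qed

lemma boost_carrier:
  "\<beta> \<in> carrier_vec q \<Longrightarrow> boost \<alpha> \<beta> x \<in> carrier_vec (Suc q)"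
  by (intro carrier_vecI) (simp add: boost_def)

lemma smult_soc:
  assumes "x \<in> soc (Suc q)" "0 \<le> c"
  shows "c \<cdot>\<^sub>v x \<in> soc (Suc q)"
proof -
  have x: "x \<in> carrier_vec (Suc q)" and le: "l2_norm (tail x) \<le> head x"
    using assms(1) by (auto simp: soc_def)
  have "tail (c \<cdot>\<^sub>v x) = c \<cdot>\<^sub>v tail x" "head (c \<cdot>\<^sub>v x) = c * head x"
    using x by (auto simp: tail_def head_def vec_last_def)
  then show ?thesis
    using x assms(2) mult_left_mono[OF le assms(2)] by (auto simp: soc_def l2_norm_smult)
qed

context
  fixes q :: nat and \<alpha> :: real and \<beta> :: "real Matrix.vec"
  assumes \<beta>: "\<beta> \<in> carrier_vec q" and \<alpha>: "0 < \<alpha>" and hyperbolic: "\<beta> \<bullet> \<beta> = \<alpha>\<^sup>2 - 1"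
begin

text \<open>The factor \<open>\<alpha> + 1\<close> cancels the denominator in the boost.\<close>

lemma hyperbolic_factored: "\<beta> \<bullet> \<beta> = (\<alpha> - 1) * (\<alpha> + 1)"
  by (simp add: hyperbolic algebra_simps power2_eq_square)

text \<open>A boost is undone by the boost in the opposite direction. With \<open>s\<close> the
  multiple of \<open>\<beta>\<close> that the first boost adds to the tail, the second one adds the
  same multiple of \<open>- \<beta>\<close>.\<close>

lemma boost_uminus_boost:
  assumes x: "x \<in> carrier_vec (Suc q)"
  shows "boost \<alpha> (- \<beta>) (boost \<alpha> \<beta> x) = x"
proof -
  obtain a z where xz: "x = vCons a z" and z: "z \<in> carrier_vec q"
    using x by (rule carrier_vec_SucE)
  define p where "p = \<beta> \<bullet> z"
  define s where "s = p / (1 + \<alpha>) - a"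
  have s: "(1 + \<alpha>) * s = p - (1 + \<alpha>) * a"
    using \<alpha> by (simp add: s_def field_simps)
  have \<beta>z': "\<beta> \<bullet> (z + s \<cdot>\<^sub>v \<beta>) = p + s * (\<beta> \<bullet> \<beta>)"
    using \<beta> z by (simp add: scalar_prod_add_distrib[of _ q] p_def)
  have p': "p + s * (\<beta> \<bullet> \<beta>) = \<alpha> * p - (\<alpha>\<^sup>2 - 1) * a"
  proof -
    have "s * (\<beta> \<bullet> \<beta>) = (\<alpha> - 1) * ((1 + \<alpha>) * s)" by (simp add: hyperbolic_factored)
    also have "\<dots> = (\<alpha> - 1) * (p - (1 + \<alpha>) * a)" by (simp only: s)
    finally show ?thesis by (simp add: algebra_simps power2_eq_square)
  qed
  have "- ((\<alpha> * p - (\<alpha>\<^sup>2 - 1) * a) / (1 + \<alpha>)) - (\<alpha> * a - p) = s"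
    using \<alpha> by (simp add: s_def field_simps power2_eq_square)
  moreover have "\<alpha> * (\<alpha> * a - p) + (\<alpha> * p - (\<alpha>\<^sup>2 - 1) * a) = a"
    by (simp add: algebra_simps power2_eq_square)
  moreover have "z + s \<cdot>\<^sub>v \<beta> + s \<cdot>\<^sub>v - \<beta> = z"
    using \<beta> z by (intro eq_vecI) auto
  ultimately show ?thesis
    using \<beta> z by (simp add: boost_def xz flip: p_def) (simp add: \<beta>z' p' flip: s_def)
qed

text \<open>A boost preserves the Lorentz form, the square of the head minus the squared norm of the
  tail, so only the sign of the new head remains to be checked.\<close>

lemma boost_soc:
  assumes "x \<in> soc (Suc q)"
  shows "boost \<alpha> \<beta> x \<in> soc (Suc q)"
proof -
  have x: "x \<in> carrier_vec (Suc q)" using assms by (simp add: soc_def)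
  obtain a z where xz: "x = vCons a z" and z: "z \<in> carrier_vec q"
    using x by (rule carrier_vec_SucE)
  have a: "0 \<le> a" "z \<bullet> z \<le> a\<^sup>2" using assms vCons_in_soc_iff[OF z] xz by auto
  define p where "p = \<beta> \<bullet> z"
  define s where "s = p / (1 + \<alpha>) - a"
  have s: "(1 + \<alpha>) * s = p - (1 + \<alpha>) * a"
    using \<alpha> by (simp add: s_def field_simps)
  have "(z + s \<cdot>\<^sub>v \<beta>) \<bullet> (z + s \<cdot>\<^sub>v \<beta>) = z \<bullet> z + 2 * s * p + s * (s * (\<beta> \<bullet> \<beta>))"
    using \<beta> z
    by (simp add: scalar_prod_add_distrib[of _ q] add_scalar_prod_distrib[of _ q] p_def
        comm_scalar_prod[of z q \<beta>] algebra_simps)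
  \<comment> \<open>Replacing \<open>(1 + \<alpha>) * s\<close> by its division-free value, here and
    once more at the end of the chain, leaves exactly the invariance of the form.\<close>
  also have "s * (s * (\<beta> \<bullet> \<beta>)) = (\<alpha> - 1) * s * ((1 + \<alpha>) * s)" by (simp add: hyperbolic_factored)
  also have "\<dots> = (\<alpha> - 1) * s * p - (\<alpha>\<^sup>2 - 1) * s * a"
    by (simp only: s) (simp add: algebra_simps power2_eq_square)
  also have "z \<bullet> z + 2 * s * p + ((\<alpha> - 1) * s * p - (\<alpha>\<^sup>2 - 1) * s * a)
      = z \<bullet> z + ((1 + \<alpha>) * s) * (p - (\<alpha> - 1) * a)" by (simp add: algebra_simps power2_eq_square)
  also have "\<dots> = z \<bullet> z - a\<^sup>2 + (\<alpha> * a - p)\<^sup>2"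
    by (simp only: s) (simp add: algebra_simps power2_eq_square)
  finally have "(z + s \<cdot>\<^sub>v \<beta>) \<bullet> (z + s \<cdot>\<^sub>v \<beta>) \<le> (\<alpha> * a - p)\<^sup>2" using a by simp
  \<comment> \<open>Cauchy-Schwarz, where the hyperbolic relation makes the norm of
    \<open>\<beta>\<close> at most \<open>\<alpha>\<close>.\<close>
  moreover have "0 \<le> \<alpha> * a - p"
  proof -
    have "p \<le> l2_norm \<beta> * l2_norm z"
      using scalar_prod_le_l2_norm[OF \<beta> z] by (simp add: p_def)
    also have "\<dots> \<le> \<alpha> * a"
    proof (rule mult_mono)
      show "l2_norm \<beta> \<le> \<alpha>" using \<alpha> by (simp add: l2_norm_def hyperbolic real_le_lsqrt)
      show "l2_norm z \<le> a" using a by (simp add: l2_norm_def real_le_lsqrt scalar_prod_self_nonneg)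
    qed (use \<alpha> in auto)
    finally show ?thesis by simp
  qed
  ultimately show ?thesis
    using \<beta> z by (simp add: boost_def xz vCons_in_soc_iff flip: p_def s_def)
qed

text \<open>The boost is symmetric and sends \<open>vCons \<alpha> \<beta>\<close> to the first unit
  vector; this turns the cut by \<open>w\<close> into a bound on the head.\<close>

lemma scalar_prod_boost:
  assumes x: "x \<in> carrier_vec (Suc q)"
  shows "vCons \<alpha> \<beta> \<bullet> boost \<alpha> \<beta> x = head x"
proof -
  obtain a z where xz: "x = vCons a z" and z: "z \<in> carrier_vec q"
    using x by (rule carrier_vec_SucE)
  define p where "p = \<beta> \<bullet> z"
  have "(p / (1 + \<alpha>) - a) * (\<beta> \<bullet> \<beta>) = (\<alpha> - 1) * (p - (1 + \<alpha>) * a)"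
    using \<alpha> by (simp add: hyperbolic_factored field_simps)
  then show ?thesis
    using \<beta> z
    by (simp add: boost_def xz scalar_prod_add_distrib[of _ q] flip: p_def)
      (simp add: algebra_simps)
qed

end

section \<open>Volume under a scaled boost\<close>

text \<open>With \<open>s = 1 / (1 + \<alpha>)\<close>, the boost factors as \<open>U V U\<close> into the shears
  \<open>U: x\<^sub>0 \<mapsto> x\<^sub>0 - s \<beta>\<^sup>T x\<^sub>1\<close> and \<open>V: x\<^sub>1 \<mapsto> x\<^sub>1 - x\<^sub>0 \<beta>\<close>, so it preserves volume; no
  determinant is needed.\<close>

lemma vol_smult_boost:
  assumes \<beta>: "\<beta> \<in> carrier_vec q" and \<alpha>: "0 < \<alpha>" and hyperbolic: "\<beta> \<bullet> \<beta> = \<alpha>\<^sup>2 - 1"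
    and g: "0 < g" and S: "S \<subseteq> carrier_vec (Suc q)" "S' \<subseteq> carrier_vec (Suc q)"
    and S': "\<And>x. x \<in> carrier_vec (Suc q) \<Longrightarrow> g \<cdot>\<^sub>v boost \<alpha> \<beta> x \<in> S' \<longleftrightarrow> x \<in> S"
    and meas: "(\<lambda>x. restrict (\<lambda>i. x $ i) {..<Suc q}) ` S' \<in> sets (Pi\<^sub>M {..<Suc q} (\<lambda>_. lborel))"
      "(\<lambda>x. restrict (\<lambda>i. x $ i) {..<Suc q}) ` S \<in> sets (Pi\<^sub>M {..<Suc q} (\<lambda>_. lborel))"
  shows "vol (Suc q) S' = ennreal (g ^ Suc q) * vol (Suc q) S"
proof -
  let ?M = "Pi\<^sub>M {..<Suc q} (\<lambda>_. lborel :: real measure)"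
  let ?I = "{1..<Suc q}"
  let ?\<phi> = "\<lambda>x :: real Matrix.vec. restrict (\<lambda>i. x $ i) {..<Suc q}"
  have ins: "insert 0 ?I = {..<Suc q}" by auto
  \<comment> \<open>Coordinate 0 is the head, so tail coordinate \<open>j\<close> pairs with entry
    \<open>j - 1\<close> of \<open>\<beta>\<close>.\<close>
  define h :: "(nat \<Rightarrow> real) \<Rightarrow> real" where "h f = - (\<Sum>j\<in>?I. \<beta> $ (j - 1) * f j) / (1 + \<alpha>)" for f
  define U where "U f = f(0 := f 0 + h (restrict f ?I))" for f
  define V where "V f = (\<lambda>j\<in>insert 0 ?I. if j = 0 then f 0 else f j + - \<beta> $ (j - 1) * f 0)" for f
  \<comment> \<open>The indicator of \<open>S'\<close> pulled back along the scaling; the summand 0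
    is the translation part in \<open>nn_integral_PiM_affine\<close>.\<close>
  define F :: "(nat \<Rightarrow> real) \<Rightarrow> ennreal" where "F f = indicator (?\<phi> ` S') (\<lambda>i\<in>{..<Suc q}. 0 + g * f i)"
    for f :: "nat \<Rightarrow> real"
  have h: "h \<in> borel_measurable (Pi\<^sub>M ?I (\<lambda>_. lborel))"
    unfolding h_def by measurable
  have U [measurable]: "U \<in> measurable ?M ?M"
    using measurable_shear_coordinate[OF h, of 0] unfolding U_def ins .
  have V [measurable]: "V \<in> measurable ?M ?M"
    using measurable_shear_along[where I = ?I and i = 0 and b = "\<lambda>j. - \<beta> $ (j - 1)"] unfolding V_def ins .
  have F [measurable]: "F \<in> borel_measurable ?M"
  proof -
    have "(\<lambda>f. \<lambda>i\<in>{..<Suc q}. 0 + g * f i) \<in> measurable ?M ?M"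
      by measurable
    moreover have "indicator (?\<phi> ` S') \<in> borel_measurable ?M"
      using meas(1) by (rule borel_measurable_indicator)
    ultimately show ?thesis unfolding F_def by (rule measurable_compose)
  qed
  have int_U: "(\<integral>\<^sup>+f. F' (U f) \<partial>?M) = (\<integral>\<^sup>+f. F' f \<partial>?M)" if "F' \<in> borel_measurable ?M" for F'
    using nn_integral_PiM_shear_coordinate[OF _ _ h, where i = 0 and F = F'] that unfolding U_def ins by simp
  have int_V: "(\<integral>\<^sup>+f. F' (V f) \<partial>?M) = (\<integral>\<^sup>+f. F' f \<partial>?M)" if "F' \<in> borel_measurable ?M" for F'
    using nn_integral_PiM_shear_along[where I = ?I and i = 0 and F = F' and b = "\<lambda>j. - \<beta> $ (j - 1)"] that unfolding V_def ins by simp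
  \<comment> \<open>The factorization checked on coordinates: the first \<open>U\<close> turns the
    head into \<open>- s\<close>, then \<open>V\<close> produces the final tail
    \<open>z + s \<beta>\<close>, and the second \<open>U\<close> corrects the head to
    \<open>\<alpha> * a - p\<close>.\<close>
  have \<phi>_boost: "(\<lambda>i\<in>{..<Suc q}. 0 + g * U (V (U (?\<phi> x))) i) = ?\<phi> (g \<cdot>\<^sub>v boost \<alpha> \<beta> x)"
    if x: "x \<in> carrier_vec (Suc q)" for x
  proof -
    obtain a z where xz: "x = vCons a z" and z: "z \<in> carrier_vec q"
      using x by (rule carrier_vec_SucE)
    have "(\<Sum>j\<in>?I. f j) = (\<Sum>j<q. f (Suc j))" for f :: "nat \<Rightarrow> real"
      using sum.shift_bounds_Suc_ivl[of f 0 q] by (simp add: atLeast0LessThan del: sum.op_ivl_Suc)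
    then have h_restrict: "h (restrict f ?I) = - (\<Sum>j<q. \<beta> $ j * f (Suc j)) / (1 + \<alpha>)" for f
      unfolding h_def by (simp del: sum.op_ivl_Suc One_nat_def)
    have U_0: "U f 0 = f 0 - (\<Sum>j<q. \<beta> $ j * f (Suc j)) / (1 + \<alpha>)" for f
      unfolding U_def h_restrict by simp
    have U_Suc: "U f (Suc j) = f (Suc j)" for f j
      by (simp add: U_def)
    define p where "p = \<beta> \<bullet> z"
    define s where "s = p / (1 + \<alpha>) - a"
    have p: "(\<Sum>j<q. \<beta> $ j * z $ j) = p"
      using z by (simp add: p_def scalar_prod_def atLeast0LessThan)
    have U1: "U (?\<phi> x) j = (if j = 0 then - s else ?\<phi> x j)" for j
      using p by (cases j) (simp_all add: U_0 U_Suc xz s_def)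
    have V1: "V (U (?\<phi> x)) j = (if j = 0 then - s else z $ (j - 1) + \<beta> $ (j - 1) * s)" if "j < Suc q" for j
      using that unfolding V_def ins by (simp add: U1) (simp add: xz vec_index_vCons)
    have "(\<Sum>j<q. \<beta> $ j * (z $ j + \<beta> $ j * s)) = (\<Sum>j<q. \<beta> $ j * z $ j) + (\<Sum>j<q. \<beta> $ j * \<beta> $ j) * s"
      by (simp add: algebra_simps sum.distrib sum_distrib_left)
    also have "\<dots> = p + (\<alpha>\<^sup>2 - 1) * s"
      using \<beta> by (simp add: p flip: hyperbolic) (simp add: scalar_prod_def atLeast0LessThan)
    finally have "U (V (U (?\<phi> x))) 0 = - s - (p + (\<alpha>\<^sup>2 - 1) * s) / (1 + \<alpha>)"
      by (simp add: U_0[of "V (U (?\<phi> x))"] V1)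
    also have "\<dots> = \<alpha> * a - p"
    proof -
      have p_eq: "p = (1 + \<alpha>) * (s + a)" using \<alpha> by (simp add: s_def)
      then have "p + (\<alpha>\<^sup>2 - 1) * s = (1 + \<alpha>) * (a + \<alpha> * s)"
        by (simp add: algebra_simps power2_eq_square)
      then have "(p + (\<alpha>\<^sup>2 - 1) * s) / (1 + \<alpha>) = a + \<alpha> * s" using \<alpha> by simp
      then show ?thesis using p_eq by (simp add: algebra_simps)
    qed
    finally have U0: "U (V (U (?\<phi> x))) 0 = \<alpha> * a - p" .
    have "U (V (U (?\<phi> x))) (Suc j) = z $ j + \<beta> $ j * s" if "j < q" for j
      using that by (simp add: U_Suc V1)
    then have "U (V (U (?\<phi> x))) i = boost \<alpha> \<beta> x $ i" if "i < Suc q" for i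
      using that U0 \<beta> z by (cases i) (simp_all add: boost_def xz flip: p_def s_def)
    then show ?thesis
      using boost_carrier[OF \<beta>, of \<alpha> x] by (auto simp: fun_eq_iff)
  qed
  have \<phi>_inj: "inj_on ?\<phi> (carrier_vec (Suc q))"
  proof (rule inj_onI)
    fix x x' :: "real Matrix.vec"
    assume x: "x \<in> carrier_vec (Suc q)" "x' \<in> carrier_vec (Suc q)" and eq: "?\<phi> x = ?\<phi> x'"
    show "x = x'"
    proof (rule eq_vecI)
      fix i assume "i < dim_vec x'"
      then show "x $ i = x' $ i" using fun_cong[OF eq, of i] x by simp
    qed (use x in auto)
  qed
  have F_boost: "F (U (V (U f))) = indicator (?\<phi> ` S) f" if f: "f \<in> space ?M" for f
  proof -
    define x where "x = Matrix.vec (Suc q) f"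
    have x: "x \<in> carrier_vec (Suc q)" by (simp add: x_def)
    have fx: "f = ?\<phi> x"
      using f by (auto simp: x_def space_PiM PiE_def extensional_def fun_eq_iff)
    have "F (U (V (U f))) = indicator (?\<phi> ` S') (?\<phi> (g \<cdot>\<^sub>v boost \<alpha> \<beta> x))"
      unfolding F_def fx \<phi>_boost[OF x] ..
    also have "?\<phi> (g \<cdot>\<^sub>v boost \<alpha> \<beta> x) \<in> ?\<phi> ` S' \<longleftrightarrow> g \<cdot>\<^sub>v boost \<alpha> \<beta> x \<in> S'"
      using boost_carrier[OF \<beta>, of \<alpha> x] by (intro inj_on_image_mem_iff[OF \<phi>_inj _ S(2)]) simp
    then have "indicator (?\<phi> ` S') (?\<phi> (g \<cdot>\<^sub>v boost \<alpha> \<beta> x)) = (indicator S x :: ennreal)"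
      using S'[OF x] by (simp add: indicator_def)
    also have "?\<phi> x \<in> ?\<phi> ` S \<longleftrightarrow> x \<in> S"
      by (rule inj_on_image_mem_iff[OF \<phi>_inj x S(1)])
    then have "(indicator S x :: ennreal) = indicator (?\<phi> ` S) f"
      by (simp add: fx indicator_def)
    finally show ?thesis .
  qed
  \<comment> \<open>The scaling yields the power of \<open>g\<close>; the shears are then inserted
    one at a time without changing the integral, until the integrand is the indicator of
    \<open>S\<close>.\<close>
  have "vol (Suc q) S' = (\<integral>\<^sup>+f. indicator (?\<phi> ` S') f \<partial>?M)"
    using meas(1) by (simp add: vol_def)
  also have "\<dots> = ennreal (\<bar>g\<bar> ^ card {..<Suc q}) * (\<integral>\<^sup>+f. F f \<partial>?M)"
    unfolding F_def using g meas(1) by (intro nn_integral_PiM_affine) auto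
  also have "(\<integral>\<^sup>+f. F f \<partial>?M) = (\<integral>\<^sup>+f. F (U f) \<partial>?M)"
    by (rule int_U[symmetric]) (rule F)
  also have "\<dots> = (\<integral>\<^sup>+f. F (U (V f)) \<partial>?M)"
    by (rule int_V[symmetric]) measurable
  also have "\<dots> = (\<integral>\<^sup>+f. F (U (V (U f))) \<partial>?M)"
    by (rule int_U[symmetric]) measurable
  also have "\<dots> = (\<integral>\<^sup>+f. indicator (?\<phi> ` S) f \<partial>?M)"
    by (rule nn_integral_cong) (rule F_boost)
  also have "\<dots> = vol (Suc q) S"
    using meas(2) by (simp add: vol_def)
  finally show ?thesis using g by simp
qed

section \<open>Cone cuts as images under scaled boosts\<close>

text \<open>In coordinates the cut is given by three polynomial inequalities, so \<open>vol\<close>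
  is meaningful on it.\<close>

lemma cone_cut_measurable:
  assumes q: "1 \<le> q" and w: "w \<in> carrier_vec (Suc q)"
  shows "(\<lambda>x. restrict (\<lambda>i. x $ i) {..<Suc q}) ` cone_cut (Suc q) w v
    \<in> sets (Pi\<^sub>M {..<Suc q} (\<lambda>_. lborel))"
proof -
  let ?M = "Pi\<^sub>M {..<Suc q} (\<lambda>_. lborel :: real measure)"
  let ?\<phi> = "\<lambda>x :: real Matrix.vec. restrict (\<lambda>i. x $ i) {..<Suc q}"
  let ?P = "\<lambda>f. 0 \<le> f 0 \<and> (\<Sum>j<q. f (Suc j) * f (Suc j)) \<le> (f 0)\<^sup>2 \<and> (\<Sum>i<Suc q. w $ i * f i) \<le> w \<bullet> v"
  have cut: "x \<in> cone_cut (Suc q) w v \<longleftrightarrow> ?P (?\<phi> x)" if x: "x \<in> carrier_vec (Suc q)" for x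
  proof -
    obtain a z where xz: "x = vCons a z" and z: "z \<in> carrier_vec q"
      using x by (rule carrier_vec_SucE)
    have "w \<bullet> x = (\<Sum>i<Suc q. w $ i * ?\<phi> x i)"
      using x by (simp add: scalar_prod_def atLeast0LessThan)
    moreover have "z \<bullet> z = (\<Sum>j<q. ?\<phi> x (Suc j) * ?\<phi> x (Suc j))"
      using z by (simp add: scalar_prod_def atLeast0LessThan xz)
    ultimately show ?thesis
      using q vCons_in_soc_iff[OF z, of a] by (simp add: cone_cut_def block_cone_def flip: xz) (simp add: xz)
  qed
  have "?\<phi> ` cone_cut (Suc q) w v = {f \<in> space ?M. ?P f}"
  proof (intro equalityI subsetI)
    fix f assume "f \<in> ?\<phi> ` cone_cut (Suc q) w v"
    then obtain x where x: "x \<in> cone_cut (Suc q) w v" "f = ?\<phi> x" by auto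
    moreover have "x \<in> carrier_vec (Suc q)"
      using x q by (auto simp: cone_cut_def block_cone_def soc_def)
    ultimately have "?P f" using cut by simp
    with x(2) show "f \<in> {f \<in> space ?M. ?P f}" by (simp add: space_PiM)
  next
    fix f assume f: "f \<in> {f \<in> space ?M. ?P f}"
    define x where "x = Matrix.vec (Suc q) f"
    have x: "x \<in> carrier_vec (Suc q)" by (simp add: x_def)
    have fx: "f = ?\<phi> x"
      using f by (auto simp: x_def space_PiM PiE_def extensional_def fun_eq_iff)
    from f have "?P f" by blast
    then have "?P (?\<phi> x)" by (simp only: fx[symmetric])
    then have "x \<in> cone_cut (Suc q) w v" using cut[OF x] by blast
    with fx show "f \<in> ?\<phi> ` cone_cut (Suc q) w v" by (rule image_eqI)
  qed
  also have "\<dots> \<in> sets ?M"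
  proof -
    have "(\<lambda>f. f i) \<in> borel_measurable ?M" if "i < Suc q" for i
      using measurable_component_singleton[of i "{..<Suc q}" "\<lambda>_. lborel :: real measure"] that by simp
    then show ?thesis
      by (intro sets.sets_Collect_conj borel_measurable_le borel_measurable_sum
          borel_measurable_times borel_measurable_power borel_measurable_const) auto
  qed
  finally show ?thesis .
qed

lemma soc_unit_scalar_prod:
  "x \<in> carrier_vec (Suc q) \<Longrightarrow> soc_unit (Suc q) \<bullet> x = head x"
  using vec_eq_vCons_head_tail[of x q] tail_carrier[of x q]
    scalar_prod_vCons[of 1 "0\<^sub>v q" "head x" "tail x"]
  by (simp add: soc_unit_def)

lemma cone_cut_soc_unit:
  assumes "1 \<le> q"
  shows "cone_cut (Suc q) (soc_unit (Suc q)) (soc_unit (Suc q)) = {x \<in> soc (Suc q). head x \<le> 1}"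
proof -
  have "soc_unit (Suc q) \<bullet> soc_unit (Suc q) = 1"
    using soc_unit_scalar_prod[of "soc_unit (Suc q)" q] by (simp add: soc_unit_def)
  then show ?thesis
    using assms soc_unit_scalar_prod by (auto simp: cone_cut_def block_cone_def soc_def)
qed

text \<open>Treats both choices of \<open>w\<close> and \<open>v\<close> at once. For
  \<open>w\<close> in the interior of the cone, division by its Lorentz length \<open>D\<close> puts
  it on the unit hyperboloid, so \<open>\<alpha>\<close> and \<open>\<beta>\<close> define a boost;
  positivity of the product of \<open>w\<close> and \<open>v\<close> makes the scaling
  invertible.\<close>

lemma cone_cut_eq_boost_image:
  assumes q: "1 \<le> q" and w1: "w1 \<in> carrier_vec q" and v: "v \<in> carrier_vec (Suc q)"
    and w: "0 < w0" "w1 \<bullet> w1 < w0\<^sup>2" "0 < vCons w0 w1 \<bullet> v"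
    and D: "D = sqrt (w0\<^sup>2 - w1 \<bullet> w1)" and \<alpha>: "\<alpha> = w0 / D" and \<beta>: "\<beta> = (1 / D) \<cdot>\<^sub>v w1"
    and G: "G = (vCons \<alpha> \<beta> \<bullet> v) \<cdot>\<^sub>m
      four_block_mat
        (Matrix.mat 1 1 (\<lambda>_. \<alpha>))
        (mat_of_rows q [- \<beta>])
        (mat_of_cols q [- \<beta>])
        (1\<^sub>m q + (1 / (1 + \<alpha>)) \<cdot>\<^sub>m (mat_of_cols q [\<beta>] * mat_of_rows q [\<beta>]))"
  shows "G \<in> cone_aut (Suc q)"
    and "(\<lambda>x. G *\<^sub>v x) ` cone_cut (Suc q) (soc_unit (Suc q)) (soc_unit (Suc q)) =
      cone_cut (Suc q) (vCons w0 w1) v"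
    and "vol (Suc q) (cone_cut (Suc q) (vCons w0 w1) v) =
      ennreal ((vCons w0 w1 \<bullet> v / D) ^ Suc q) * soc_vol (Suc q)"
proof -
  define g where "g = vCons \<alpha> \<beta> \<bullet> v"
  have D0: "0 < D" and D2: "D\<^sup>2 = w0\<^sup>2 - w1 \<bullet> w1" using w by (auto simp: D)
  have \<beta>q: "\<beta> \<in> carrier_vec q" using w1 by (simp add: \<beta>)
  have \<alpha>0: "0 < \<alpha>" using w D0 by (simp add: \<alpha>)
  have hyp: "\<beta> \<bullet> \<beta> = \<alpha>\<^sup>2 - 1"
    using D0 D2 by (simp add: \<alpha> \<beta> power_divide field_simps power2_eq_square)
  have w_eq: "vCons w0 w1 = D \<cdot>\<^sub>v vCons \<alpha> \<beta>"
    using D0 by (intro eq_vecI) (auto simp: \<alpha> \<beta> vec_index_vCons)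
  have wx: "vCons w0 w1 \<bullet> x = D * (vCons \<alpha> \<beta> \<bullet> x)" if "x \<in> carrier_vec (Suc q)" for x
    unfolding w_eq using that \<beta>q by (intro smult_scalar_prod_distrib[of _ "Suc q"]) auto
  have g: "0 < g" "g = vCons w0 w1 \<bullet> v / D"
    using w(3) D0 by (auto simp: wx[OF v] g_def zero_less_mult_iff)
  have \<beta>m: "- \<beta> \<in> carrier_vec q" "- \<beta> \<bullet> - \<beta> = \<alpha>\<^sup>2 - 1" using \<beta>q hyp by auto
  have Gx: "G *\<^sub>v x = g \<cdot>\<^sub>v boost \<alpha> \<beta> x" if "x \<in> carrier_vec (Suc q)" for x
    unfolding G g_def by (rule boost_mat_mult_vec[OF \<beta>q that])
  have soc_carrier: "x \<in> carrier_vec (Suc q)" if "x \<in> soc (Suc q)" for x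
    using that by (simp add: soc_def)
  have G_soc: "G *\<^sub>v x \<in> soc (Suc q)" if "x \<in> soc (Suc q)" for x
    using that g(1) by (simp add: Gx soc_carrier smult_soc boost_soc[OF \<beta>q \<alpha>0 hyp])
  \<comment> \<open>The inverse of \<open>G\<close>: undo the scaling, then boost in the opposite
    direction.\<close>
  define H where "H z = boost \<alpha> (- \<beta>) ((1 / g) \<cdot>\<^sub>v z)" for z
  have H_soc: "H z \<in> soc (Suc q)" if "z \<in> soc (Suc q)" for z
    using that g(1) by (simp add: H_def smult_soc boost_soc[OF \<beta>m(1) \<alpha>0 \<beta>m(2)])
  have GH: "G *\<^sub>v H z = z" if "z \<in> carrier_vec (Suc q)" for z
  proof -
    have "boost \<alpha> \<beta> (H z) = (1 / g) \<cdot>\<^sub>v z"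
      using boost_uminus_boost[OF \<beta>m(1) \<alpha>0 \<beta>m(2), of "(1 / g) \<cdot>\<^sub>v z"] that by (simp add: H_def)
    then show ?thesis
      using g(1) by (simp add: Gx H_def boost_carrier \<beta>q smult_smult_assoc)
  qed
  have HG: "H (G *\<^sub>v x) = x" if "x \<in> carrier_vec (Suc q)" for x
    using that g(1) boost_uminus_boost[OF \<beta>q \<alpha>0 hyp that] by (simp add: H_def Gx smult_smult_assoc)
  have wGx: "vCons w0 w1 \<bullet> (G *\<^sub>v x) = (vCons w0 w1 \<bullet> v) * head x" if "x \<in> carrier_vec (Suc q)" for x
  proof -
    have "vCons w0 w1 \<bullet> (G *\<^sub>v x) = D * (g * (vCons \<alpha> \<beta> \<bullet> boost \<alpha> \<beta> x))"
      using that \<beta>q boost_carrier[OF \<beta>q, of \<alpha> x]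
      by (simp add: Gx wx scalar_prod_smult_distrib[of _ "Suc q"])
    then show ?thesis using D0 by (simp add: scalar_prod_boost[OF \<beta>q \<alpha>0 hyp that] g(2))
  qed
  have cut_iff: "G *\<^sub>v x \<in> cone_cut (Suc q) (vCons w0 w1) v \<longleftrightarrow>
      x \<in> cone_cut (Suc q) (soc_unit (Suc q)) (soc_unit (Suc q))" if x: "x \<in> carrier_vec (Suc q)" for x
  proof -
    have "G *\<^sub>v x \<in> soc (Suc q) \<longleftrightarrow> x \<in> soc (Suc q)"
      using G_soc H_soc[of "G *\<^sub>v x"] HG[OF x] by auto
    moreover have "(vCons w0 w1 \<bullet> v) * head x \<le> vCons w0 w1 \<bullet> v \<longleftrightarrow> head x \<le> 1"
      using w(3) by (simp add: mult_le_cancel_left1)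
    ultimately show ?thesis
      using q by (simp add: cone_cut_soc_unit) (simp add: cone_cut_def block_cone_def wGx[OF x])
  qed
  have cut_soc: "cone_cut (Suc q) w' v' \<subseteq> soc (Suc q)" for w' v'
    using q by (auto simp: cone_cut_def block_cone_def)
  show "G \<in> cone_aut (Suc q)"
  proof -
    have "(\<lambda>x. G *\<^sub>v x) ` soc (Suc q) = soc (Suc q)"
    proof (intro equalityI subsetI)
      fix z assume "z \<in> soc (Suc q)"
      then have "z = G *\<^sub>v H z" "H z \<in> soc (Suc q)" using GH H_soc soc_carrier by auto
      then show "z \<in> (\<lambda>x. G *\<^sub>v x) ` soc (Suc q)" by blast
    qed (use G_soc in auto)
    moreover have "G \<in> carrier_mat (Suc q) (Suc q)"
      unfolding G by (rule carrier_matI) simp_all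
    ultimately show ?thesis using q by (simp add: cone_aut_def block_cone_def)
  qed
  show "(\<lambda>x. G *\<^sub>v x) ` cone_cut (Suc q) (soc_unit (Suc q)) (soc_unit (Suc q)) =
      cone_cut (Suc q) (vCons w0 w1) v"
  proof (intro equalityI subsetI)
    fix z assume z: "z \<in> cone_cut (Suc q) (vCons w0 w1) v"
    then have "z \<in> soc (Suc q)" using cut_soc by blast
    then have "z = G *\<^sub>v H z" "H z \<in> carrier_vec (Suc q)" using GH H_soc soc_carrier by auto
    moreover then have "H z \<in> cone_cut (Suc q) (soc_unit (Suc q)) (soc_unit (Suc q))"
      using cut_iff[of "H z"] z by simp
    ultimately show "z \<in> (\<lambda>x. G *\<^sub>v x) ` cone_cut (Suc q) (soc_unit (Suc q)) (soc_unit (Suc q))"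
      by blast
  next
    fix z assume "z \<in> (\<lambda>x. G *\<^sub>v x) ` cone_cut (Suc q) (soc_unit (Suc q)) (soc_unit (Suc q))"
    then show "z \<in> cone_cut (Suc q) (vCons w0 w1) v"
      using cut_iff cut_soc soc_carrier by blast
  qed
  have "vol (Suc q) (cone_cut (Suc q) (vCons w0 w1) v) =
      ennreal (g ^ Suc q) * vol (Suc q) (cone_cut (Suc q) (soc_unit (Suc q)) (soc_unit (Suc q)))"
  proof (rule vol_smult_boost[OF \<beta>q \<alpha>0 hyp g(1)])
    show "g \<cdot>\<^sub>v boost \<alpha> \<beta> x \<in> cone_cut (Suc q) (vCons w0 w1) v \<longleftrightarrow>
        x \<in> cone_cut (Suc q) (soc_unit (Suc q)) (soc_unit (Suc q))" if "x \<in> carrier_vec (Suc q)" for x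
      using cut_iff[OF that] by (simp add: Gx[OF that])
  qed (use cut_soc soc_carrier w1 in \<open>auto intro!: cone_cut_measurable[OF q] simp: soc_unit_def\<close>)
  also have "vol (Suc q) (cone_cut (Suc q) (soc_unit (Suc q)) (soc_unit (Suc q))) = soc_vol (Suc q)"
    unfolding cone_cut_soc_unit[OF q] soc_vol_def by (simp add: soc_def conj_assoc)
  finally show "vol (Suc q) (cone_cut (Suc q) (vCons w0 w1) v) =
      ennreal ((vCons w0 w1 \<bullet> v / D) ^ Suc q) * soc_vol (Suc q)"
    by (simp only: g(2))
qed

section \<open>The cut for feasible points and the two choices of \<open>w\<close> and
  \<open>v\<close>\<close>

lemma feas_block_scalar_prod_le:
  assumes dims: "\<And>i. i < n \<Longrightarrow> d i \<ge> 1" and A: "A \<in> carrier_mat m (\<Sum>i<n. d i)"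
    and y: "y \<in> prod_cone n d" and k: "k < n"
    and small: "2 * sqrt (real n) * l2_norm (ker_proj A y) \<le> head (block d k y)"
    and x: "x \<in> feas n d A"
  shows "block d k y \<bullet> block d k x \<le> head (block d k y) / sqrt 2"
proof -
  \<comment> \<open>One more factor \<open>sqrt 2\<close> produces the constant 2 of the smallness
    assumption.\<close>
  have "sqrt 2 * (block d k y \<bullet> block d k x) \<le>
      sqrt 2 * (sqrt 2 * sqrt (real n) * l2_norm (ker_proj A y))"
    using block_scalar_prod_le[OF dims A y k x] by (intro mult_left_mono) auto
  also have "\<dots> = 2 * sqrt (real n) * l2_norm (ker_proj A y)"
    by simp
  finally show ?thesis using small by (simp add: field_simps)
qed

theorem mainTheorem3:
  fixes n m k :: nat and d :: "nat \<Rightarrow> nat"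
    and A G :: "real Matrix.mat" and y yhat w v \<beta> :: "real Matrix.vec" and \<eta> \<alpha> :: real
  assumes dims: "\<And>i. i < n \<Longrightarrow> d i \<ge> 1"
    and A: "A \<in> carrier_mat m (\<Sum>i<n. d i)" "lin_indep_rows A"
    and y: "y \<in> prod_cone n d"
    and k: "k < n" "d k \<ge> 2" "head (block d k y) > 0"
    and small: "2 * sqrt (real n) * l2_norm (ker_proj A y) \<le> head (block d k y)"
    and yhat: "yhat = (1 / head (block d k y)) \<cdot>\<^sub>v block d k y"
    and eta: "\<eta> = l2_norm (tail yhat)"
    and case1: "0 \<le> \<eta> \<and> \<eta> \<le> 0.6 \<Longrightarrow>
      w = block d k y \<and> v = (1 / sqrt 2) \<cdot>\<^sub>v soc_unit (d k)"
    and case2: "0.6 < \<eta> \<and> \<eta> \<le> 1 \<Longrightarrow>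
      w = vCons 1 ((1 / \<eta>\<^sup>2 * (1 - 1 / sqrt 2)) \<cdot>\<^sub>v tail yhat) \<and>
      v = vCons 1 ((- (1 / \<eta>\<^sup>2 * (1 - 1 / sqrt 2))) \<cdot>\<^sub>v tail yhat)"
    and alpha: "\<alpha> = head w / sqrt ((head w)\<^sup>2 - (l2_norm (tail w))\<^sup>2)"
    and beta: "\<beta> = (1 / sqrt ((head w)\<^sup>2 - (l2_norm (tail w))\<^sup>2)) \<cdot>\<^sub>v tail w"
    and G: "G = (vCons \<alpha> \<beta> \<bullet> v) \<cdot>\<^sub>m
      four_block_mat
        (Matrix.mat 1 1 (\<lambda>_. \<alpha>))
        (mat_of_rows (d k - 1) [- \<beta>])
        (mat_of_cols (d k - 1) [- \<beta>])
        (1\<^sub>m (d k - 1) +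
          (1 / (1 + \<alpha>)) \<cdot>\<^sub>m (mat_of_cols (d k - 1) [\<beta>] * mat_of_rows (d k - 1) [\<beta>]))"
  shows "\<eta> \<in> {0..1} \<and>
    block d k ` feas n d A \<subseteq> cone_cut (d k) w v \<and>
    vol (d k) (cone_cut (d k) w v) \<le> ennreal (0.96 ^ d k) * soc_vol (d k) \<and>
    G \<in> cone_aut (d k) \<and>
    (\<lambda>x. G *\<^sub>v x) ` cone_cut (d k) (soc_unit (d k)) (soc_unit (d k)) = cone_cut (d k) w v"
proof -
  define \<kappa> where "\<kappa> = 1 - 1 / sqrt (2 :: real)"
  define c where "c = 1 / \<eta>\<^sup>2 * \<kappa>"
  \<comment> \<open>The bracket 0.707 to 0.708 for \<open>1 / sqrt 2\<close> supports all numerical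
    estimates below.\<close>
  have sqrt2: "1 / sqrt 2 = 1 - \<kappa>" "0.292 < \<kappa>" "\<kappa> < 0.293"
  proof -
    have "1 / sqrt 2 = sqrt (1 / 2 :: real)" by (simp add: real_sqrt_divide)
    moreover have "0.707 < sqrt (1 / 2 :: real)"
      by (rule real_less_rsqrt) (simp add: power2_eq_square)
    moreover have "sqrt (1 / 2 :: real) < 0.708"
      by (rule real_less_lsqrt) (simp_all add: power2_eq_square)
    ultimately show "1 / sqrt 2 = 1 - \<kappa>" "0.292 < \<kappa>" "\<kappa> < 0.293" by (auto simp: \<kappa>_def)
  qed
  obtain q where dk: "d k = Suc q" and q: "1 \<le> q" using k(2) by (cases "d k") auto
  define yk where "yk = block d k y"
  have "yk \<in> block_cone (d k)" using y k(1) by (simp add: prod_cone_def yk_def)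
  then have yk_soc: "yk \<in> soc (Suc q)" using q by (simp add: dk block_cone_def)
  then have ykc: "yk \<in> carrier_vec (Suc q)" by (simp add: soc_def)
  obtain a z where az: "yk = vCons a z" and z: "z \<in> carrier_vec q"
    using ykc by (rule carrier_vec_SucE)
  have a: "0 < a" "z \<bullet> z \<le> a\<^sup>2"
    using k(3) yk_soc vCons_in_soc_iff[OF z, of a] by (auto simp: az simp flip: yk_def)
  define u where "u = (1 / a) \<cdot>\<^sub>v z"
  have u: "u \<in> carrier_vec q" using z by (simp add: u_def)
  have yhat_eq: "yhat = vCons 1 u"
    unfolding yhat yk_def[symmetric] az using a by (intro eq_vecI) (auto simp: vec_index_vCons u_def)
  have \<eta>: "\<eta> = l2_norm u" "\<eta>\<^sup>2 = u \<bullet> u" "0 \<le> \<eta>" by (simp_all add: eta yhat_eq l2_norm_square)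
  have zz: "z \<bullet> z = a\<^sup>2 * \<eta>\<^sup>2"
    unfolding \<eta>(2) using a(1) z by (simp add: u_def power2_eq_square)
  have \<eta>1: "\<eta> \<le> 1"
  proof -
    have "\<eta>\<^sup>2 \<le> 1" using a by (simp add: zz mult_le_cancel_left1)
    then show ?thesis using \<eta>(3) by (simp add: power_le_one_iff)
  qed
  have block_cut: "yk \<bullet> block d k x \<le> a * (1 - \<kappa>)" if "x \<in> feas n d A" for x
    using feas_block_scalar_prod_le[OF dims A(1) y k(1) small that]
    by (simp add: az flip: yk_def sqrt2(1))
  have feas_block: "block d k x \<in> block_cone (d k)" "block d k x \<in> carrier_vec (Suc q)"
    "head (block d k x) \<le> 1" if "x \<in> feas n d A" for x
    using that feas_block_head_le[OF that k(1)] k block_carrier[of d k x]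
    by (auto simp: feas_def prod_cone_def head_def dk)
  \<comment> \<open>All that the rest of the proof uses about the two cases. The constant 0.96
    enters as a bound on the scaling factor: the product of \<open>w\<close> and \<open>v\<close>
    divided by the Lorentz length of \<open>w\<close>.\<close>
  obtain w0 w1 where w: "w = vCons w0 w1" "w1 \<in> carrier_vec q" "0 < w0" "w1 \<bullet> w1 < w0\<^sup>2"
    and v: "v \<in> carrier_vec (Suc q)" "0 < w \<bullet> v" "w \<bullet> v \<le> 0.96 * sqrt (w0\<^sup>2 - w1 \<bullet> w1)"
    and cut: "\<And>x. x \<in> feas n d A \<Longrightarrow> w \<bullet> block d k x \<le> w \<bullet> v"
  proof (cases "\<eta> \<le> 0.6")
    case True
    with case1 \<eta>(3) have w: "w = vCons a z" and v: "v = (1 - \<kappa>) \<cdot>\<^sub>v soc_unit (Suc q)"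
      by (auto simp: az dk sqrt2(1) simp flip: yk_def)
    have unit: "soc_unit (Suc q) \<in> carrier_vec (Suc q)" by (simp add: soc_unit_def)
    have wv: "w \<bullet> v = (1 - \<kappa>) * a"
      using z unit soc_unit_scalar_prod[of w q] comm_scalar_prod[of w "Suc q" "soc_unit (Suc q)"]
      by (simp add: w v scalar_prod_smult_distrib[of _ "Suc q"])
    have \<eta>2: "\<eta>\<^sup>2 \<le> 9 / 25" using power_mono[OF True \<eta>(3), of 2] by (simp add: power2_eq_square)
    have a2: "0 < a\<^sup>2" using a(1) by simp
    have le: "z \<bullet> z \<le> 9 / 25 * a\<^sup>2"
      using mult_left_mono[OF \<eta>2, of "a\<^sup>2"] by (simp add: zz)
    \<comment> \<open>Since 1 - 0.6^2 = 0.8^2. The scaling factor is then at most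
      \<open>1 / sqrt 2\<close> divided by 0.8, and 0.96 times 0.8 is 0.768, which exceeds
      \<open>1 / sqrt 2\<close>.\<close>
    have "0.8 * a \<le> sqrt (a\<^sup>2 - z \<bullet> z)"
      using le by (intro real_le_rsqrt) (simp add: power2_eq_square)
    moreover have "(1 - \<kappa>) * a \<le> 0.768 * a" using a sqrt2 by (intro mult_right_mono) auto
    ultimately have "w \<bullet> v \<le> 0.96 * sqrt (a\<^sup>2 - z \<bullet> z)" by (simp add: wv)
    moreover have "z \<bullet> z < a\<^sup>2" using le a2 by linarith
    moreover have "0 < w \<bullet> v" using a sqrt2 by (simp add: wv)
    moreover have "w \<bullet> block d k x \<le> w \<bullet> v" if "x \<in> feas n d A" for x
      unfolding wv using block_cut[OF that] by (simp add: w az mult.commute)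
    moreover have "v \<in> carrier_vec (Suc q)" using unit by (simp add: v)
    ultimately show ?thesis using that[OF w z a(1)] by blast
  next
    case False
    with case2 \<eta>1 have w: "w = vCons 1 (c \<cdot>\<^sub>v u)" and v: "v = vCons 1 ((- c) \<cdot>\<^sub>v u)"
      by (auto simp: yhat_eq c_def \<kappa>_def)
    have \<eta>2: "9 / 25 < \<eta>\<^sup>2"
      using False power_strict_mono[of "0.6" \<eta> 2] by (simp add: power2_eq_square)
    then have \<eta>0: "0 < \<eta>\<^sup>2" by linarith
    have c_eq: "c = \<kappa> / \<eta>\<^sup>2" by (simp add: c_def)
    have c\<eta>: "c * \<eta>\<^sup>2 = \<kappa>" unfolding c_eq using \<eta>0 by simp
    \<comment> \<open>The threshold 0.6 matters here: \<kappa> < 0.293 < 0.36 <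
      \<open>\<eta>\<^sup>2\<close>, which makes \<open>1 - c\<close> and \<open>c\<close> convex
      weights.\<close>
    have "c < 1" using \<eta>0 \<eta>2 sqrt2(3) by (simp add: c_eq pos_divide_less_eq)
    have "\<kappa> \<le> c"
    proof -
      have "\<eta>\<^sup>2 \<le> 1" using \<eta>1 \<eta>(3) by (simp add: power_le_one)
      then have "\<kappa> * \<eta>\<^sup>2 \<le> \<kappa> * 1" using sqrt2(2) by (intro mult_left_mono) auto
      then show ?thesis using \<eta>0 by (simp add: c_eq pos_le_divide_eq)
    qed
    have ww: "(c \<cdot>\<^sub>v u) \<bullet> (c \<cdot>\<^sub>v u) = c * \<kappa>"
      using u by (simp add: \<eta>(2)[symmetric] c\<eta>[symmetric])
    \<comment> \<open>As \<open>v\<close> mirrors \<open>w\<close>, their product is the squared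
      Lorentz length of \<open>w\<close>, so the scaling factor is
      \<open>sqrt (1 - c * \<kappa>)\<close>.\<close>
    have wv: "w \<bullet> v = 1 - c * \<kappa>"
      using u by (simp add: w v \<eta>(2)[symmetric] c\<eta>[symmetric])
    have c\<kappa>: "c * \<kappa> < 1" "0.085 \<le> c * \<kappa>"
    proof -
      have "c * \<kappa> \<le> 1 * \<kappa>" using \<open>c < 1\<close> sqrt2(2) by (intro mult_right_mono) auto
      then show "c * \<kappa> < 1" using sqrt2(3) by simp
      have "0.292 * 0.292 \<le> c * \<kappa>" using \<open>\<kappa> \<le> c\<close> sqrt2(2) by (intro mult_mono) auto
      then show "0.085 \<le> c * \<kappa>" by simp
    qed
    \<comment> \<open>From 1 - 0.085 = 0.915 and 0.96^2 = 0.9216.\<close>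
    have "sqrt (1 - c * \<kappa>) \<le> 0.96"
      using c\<kappa> by (intro real_le_lsqrt) (auto simp: power2_eq_square)
    then have "sqrt (1 - c * \<kappa>) * sqrt (1 - c * \<kappa>) \<le> 0.96 * sqrt (1 - c * \<kappa>)"
      using c\<kappa> by (intro mult_right_mono) auto
    then have "w \<bullet> v \<le> 0.96 * sqrt (1\<^sup>2 - (c \<cdot>\<^sub>v u) \<bullet> (c \<cdot>\<^sub>v u))"
      using c\<kappa> by (simp only: wv ww) simp
    moreover have "w \<bullet> block d k x \<le> w \<bullet> v" if x: "x \<in> feas n d A" for x
    proof -
      obtain b t where bt: "block d k x = vCons b t" and t: "t \<in> carrier_vec q"
        using feas_block(2)[OF x] by (rule carrier_vec_SucE)
      have "b \<le> 1" using feas_block(3)[OF x] by (simp add: bt)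
      have "z = a \<cdot>\<^sub>v u" using a(1) z by (simp add: u_def smult_smult_assoc)
      then have "a * (b + u \<bullet> t) \<le> a * (1 - \<kappa>)"
        using block_cut[OF x] u t by (simp add: az bt algebra_simps)
      then have "b + u \<bullet> t \<le> 1 - \<kappa>" using a(1) by simp
      \<comment> \<open>The convex combination of the head bound and the cut by the normalized block
        of \<open>y\<close>; the same combination of the two right-hand sides is
        \<open>1 - c * \<kappa>\<close>.\<close>
      have "w \<bullet> block d k x = (1 - c) * b + c * (b + u \<bullet> t)"
        using u t by (simp add: w bt algebra_simps)
      also have "\<dots> \<le> (1 - c) * 1 + c * (1 - \<kappa>)"
        using \<open>b \<le> 1\<close> \<open>b + u \<bullet> t \<le> 1 - \<kappa>\<close> \<open>c < 1\<close> \<open>\<kappa> \<le> c\<close> sqrt2(2)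
        by (intro add_mono mult_left_mono) auto
      also have "\<dots> = w \<bullet> v" by (simp add: wv algebra_simps)
      finally show ?thesis .
    qed
    moreover have "v \<in> carrier_vec (Suc q)" "c \<cdot>\<^sub>v u \<in> carrier_vec q" using u by (auto simp: v)
    moreover have "0 < w \<bullet> v" "(c \<cdot>\<^sub>v u) \<bullet> (c \<cdot>\<^sub>v u) < 1\<^sup>2"
      using c\<kappa> by (simp_all only: wv ww) simp_all
    moreover have "0 < (1 :: real)" by simp
    ultimately show ?thesis using that[OF w] by blast
  qed
  define D where "D = sqrt (w0\<^sup>2 - w1 \<bullet> w1)"
  have norm_w: "head w = w0" "tail w = w1" "(l2_norm w1)\<^sup>2 = w1 \<bullet> w1"
    by (simp_all add: w(1) l2_norm_square)
  have \<alpha>: "\<alpha> = w0 / D" and \<beta>: "\<beta> = (1 / D) \<cdot>\<^sub>v w1"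
    unfolding alpha beta norm_w D_def by auto
  have D: "0 < D" using w(4) by (simp add: D_def)
  have Suc: "d k - 1 = q" by (simp add: dk)
  note props = cone_cut_eq_boost_image[OF q w(2) v(1) w(3,4) v(2)[unfolded w(1)] D_def \<alpha> \<beta>
      G[unfolded Suc], folded w(1)]
  have "block d k ` feas n d A \<subseteq> cone_cut (d k) w v"
    using cut feas_block(1) by (auto simp: cone_cut_def)
  moreover have "vol (d k) (cone_cut (d k) w v) \<le> ennreal (0.96 ^ d k) * soc_vol (d k)"
  proof -
    have "w \<bullet> v / D \<le> 0.96" using v(3) D by (simp add: D_def[symmetric] pos_divide_le_eq)
    then have "(w \<bullet> v / D) ^ d k \<le> 0.96 ^ d k"
      using v(2) D by (intro power_mono) auto
    then show ?thesis
      unfolding dk props(3) by (intro mult_right_mono ennreal_leI) auto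
  qed
  ultimately show ?thesis
    using props(1,2) \<eta>(3) \<eta>1 by (simp add: dk)
qed

end
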